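(* Let $B\subset\mathbb{R}^3$ be the unit ball centered at the origin and, for $k>0$, let $(\mathcal{K}_B^k)^*$ be the Neumann-Poincaré operator of $B$ for the Helmholtz operator $\Delta+k^2$. For each integer $n\ge 0$ let $\tau_{n,k}\in\mathbb{C}$ be the eigenvalue defined by $$(\mathcal{K}_B^k)^*[Y_n^m]=\tau_{n,k}\,Y_n^m ,$$ which does not depend on $m$, $-n\le m\le n$. Then for every integer $n\ge 0$, $$\lim_{k\to 0}\tau_{n,k}=\frac{1}{2(2n+1)}.$$
   Context: For $k>0$ put $G_k(\mathbf{x})=-\dfrac{e^{ik|\mathbf{x}|}}{4\pi|\mathbf{x}|}$, $\mathbf{x}\in\mathbb{R}^3\setminus\{0\}$, the fundamental solution of $\Delta+k^2$. The Neumann-Poincaré operator $(\mathcal{K}_B^k)^*:H^{-1/2}(\partial B)\to H^{-1/2}(\partial B)$ is $$(\mathcal{K}_B^k)^*[\phi](\mathbf{x})=\mathrm{p.v.}\int_{\partial B}\frac{\partial G_k(\mathbf{x}-\mathbf{y})}{\partial\nu_{\mathbf{x}}}\,\phi(\mathbf{y})\,ds_{\mathbf{y}},\qquad \mathbf{x}\in\partial B,$$ where $\nu$ is the exterior unit normal to $\partial B$, the normal derivative is taken in the variable $\mathbf{x}$, and p.v. denotes the Cauchy principal value. $Y_n^m$ ($n\ge 0$, $-n\le m\le n$) are the spherical harmonics of order $n$ and degree $m$ on the unit sphere $\partial B=\mathbb{S}^2$; each $Y_n^m$ is an eigenfunction of $(\mathcal{K}_B^k)^*$ with eigenvalue independent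 of $m$. *)

theory Defs
  imports "HOL-Analysis.Analysis" "HOL-Computational_Algebra.Polynomial"
begin

definition helmholtz_G :: "real \<Rightarrow> real^3 \<Rightarrow> complex" where
  "helmholtz_G k x = - exp (\<i> * complex_of_real (k * norm x)) / complex_of_real (4 * pi * norm x)"


section \<open>Surface measure of the unit sphere\<close>

definition sphere_param :: "real \<times> real \<Rightarrow> real^3" where
  "sphere_param = (\<lambda>(\<theta>, \<phi>). vector [sin \<theta> * cos \<phi>, sin \<theta> * sin \<phi>, cos \<theta>])"

text \<open>The density is the area element of the parametrization by spherical coordinates, see
  \<open>sphere_param_area_element\<close> below.  As a measure on the Borel sets of \<open>\<real>\<^sup>3\<close> it is concentrated
  on \<open>sphere 0 1\<close>.\<close>

definition sphere_measure :: "(real^3) measure" where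
  "sphere_measure =
     distr (density lborel (\<lambda>(\<theta>, \<phi>). ennreal (indicator ({0..pi} \<times> {0..2 * pi}) (\<theta>, \<phi>) * sin \<theta>)))
       borel sphere_param"

lemma vector_3_axis:
  "vector [a, b, c] = a *\<^sub>R axis 1 1 + b *\<^sub>R axis 2 1 + c *\<^sub>R (axis 3 1 :: real^3)"
  by (simp add: vec_eq_iff forall_3 vector_3 axis_def)

lemma sphere_param_measurable: "sphere_param \<in> borel_measurable borel"
  unfolding sphere_param_def vector_3_axis case_prod_beta
  by (intro borel_measurable_continuous_onI continuous_intros)

lemma sphere_param_derivs:
  "((\<lambda>\<theta>. sphere_param (\<theta>, \<phi>)) has_vector_derivative
      vector [cos \<theta> * cos \<phi>, cos \<theta> * sin \<phi>, - sin \<theta>]) (at \<theta>)"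
  "((\<lambda>\<phi>. sphere_param (\<theta>, \<phi>)) has_vector_derivative
      vector [- sin \<theta> * sin \<phi>, sin \<theta> * cos \<phi>, 0]) (at \<phi>)"
proof -
  show "((\<lambda>\<theta>. sphere_param (\<theta>, \<phi>)) has_vector_derivative
      vector [cos \<theta> * cos \<phi>, cos \<theta> * sin \<phi>, - sin \<theta>]) (at \<theta>)"
    "((\<lambda>\<phi>. sphere_param (\<theta>, \<phi>)) has_vector_derivative
      vector [- sin \<theta> * sin \<phi>, sin \<theta> * cos \<phi>, 0]) (at \<phi>)"
    unfolding sphere_param_def case_prod_conv vector_3_axis
    by (auto intro!: derivative_eq_intros simp: algebra_simps)
qed

lemma sphere_param_area_element:
  assumes "\<theta> \<in> {0..pi}"
  shows "norm (cross3 (vector_derivative (\<lambda>\<theta>. sphere_param (\<theta>, \<phi>)) (at \<theta>))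
                      (vector_derivative (\<lambda>\<phi>. sphere_param (\<theta>, \<phi>)) (at \<phi>))) = sin \<theta>"
proof -
  have "cross3 (vector [cos \<theta> * cos \<phi>, cos \<theta> * sin \<phi>, - sin \<theta>])
               (vector [- sin \<theta> * sin \<phi>, sin \<theta> * cos \<phi>, 0]) = sin \<theta> *\<^sub>R sphere_param (\<theta>, \<phi>)"
  proof -
    have "cos \<theta> * cos \<phi> * (sin \<theta> * cos \<phi>) + cos \<theta> * sin \<phi> * (sin \<theta> * sin \<phi>) = sin \<theta> * cos \<theta>"
      using sin_cos_squared_add[of \<phi>] by algebra
    then show ?thesis
      by (simp add: cross3_def sphere_param_def vec_eq_iff forall_3 vector_3 power2_eq_square)
  qed
  moreover have "norm (sphere_param (\<theta>, \<phi>)) = 1"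
  proof -
    have "(sin \<theta> * cos \<phi>)\<^sup>2 + (sin \<theta> * sin \<phi>)\<^sup>2 + (cos \<theta>)\<^sup>2 = 1"
      using sin_cos_squared_add[of \<theta>] sin_cos_squared_add[of \<phi>] by algebra
    then show ?thesis
      by (simp add: sphere_param_def norm_eq_1 inner_vec_def sum_3 vector_3 power2_eq_square)
  qed
  moreover have "0 \<le> sin \<theta>"
    using assms by (simp add: sin_ge_zero)
  ultimately show ?thesis
    by (simp add: vector_derivative_at[OF sphere_param_derivs(1)]
        vector_derivative_at[OF sphere_param_derivs(2)])
qed


section \<open>The Neumann--Poincare operator of the unit ball\<close>

definition ball_normal :: "real^3 \<Rightarrow> real^3" where
  "ball_normal x = x /\<^sub>R norm x"

definition NP_kernel :: "real \<Rightarrow> real^3 \<Rightarrow> real^3 \<Rightarrow> complex" where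
  "NP_kernel k x y = frechet_derivative (\<lambda>z. helmholtz_G k (z - y)) (at x) (ball_normal x)"

text \<open>The operator is given by its principal value integral, for densities that are functions
  on the sphere (values off the sphere are irrelevant).\<close>

definition NP :: "real \<Rightarrow> (real^3 \<Rightarrow> complex) \<Rightarrow> real^3 \<Rightarrow> complex" where
  "NP k f x = Lim (at_right 0)
     (\<lambda>\<epsilon>. LINT y:{y \<in> sphere 0 1. \<epsilon> < dist x y}|sphere_measure. NP_kernel k x y * f y)"


section \<open>Spherical harmonics\<close>

text \<open>Rodrigues' formula.\<close>

definition legendre_poly :: "nat \<Rightarrow> real poly" where
  "legendre_poly n = smult (1 / (2 ^ n * fact n)) ((pderiv ^^ n) ([:-1, 0, 1:] ^ n))"

text \<open>The factor \<open>(1 - t\<^sup>2)\<^bsup>m/2\<^esup>\<close> is not written with \<open>powr\<close>, because \<open>0 powr 0 = 0\<close>.\<close>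

definition assoc_legendre :: "nat \<Rightarrow> nat \<Rightarrow> real \<Rightarrow> real" where
  "assoc_legendre n m t = sqrt (1 - t\<^sup>2) ^ m * poly ((pderiv ^^ m) (legendre_poly n)) t"

text \<open>The orthonormal spherical harmonics, in the phase convention of Colton and Kress (no
  Condon--Shortley phase), at the point \<open>x\<close> of the unit sphere with polar angle \<open>\<theta>\<close>,
  \<open>cos \<theta> = x $ 3\<close>, and azimuth \<open>Arg (x $ 1 + \<i> x $ 2)\<close>.  At the poles, where the azimuth is
  undefined, \<open>assoc_legendre\<close> vanishes unless \<open>m = 0\<close>.\<close>

definition sph_harm :: "nat \<Rightarrow> int \<Rightarrow> real^3 \<Rightarrow> complex" where
  "sph_harm n m x =
     complex_of_real (sqrt ((2 * real n + 1) / (4 * pi) *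
                            (fact (n - nat \<bar>m\<bar>) / fact (n + nat \<bar>m\<bar>))) *
                      assoc_legendre n (nat \<bar>m\<bar>) (x $ 3)) *
     cis (of_int m * Arg (Complex (x $ 1) (x $ 2)))"

end

theory Submission imports Defs begin

text \<open>Only the zonal harmonics at the north pole matter.  For \<open>x\<close>, \<open>y\<close> on the unit sphere and
  \<open>r = \<bar>x - y\<bar>\<close> we have \<open>(x - y) \<bullet> x = r\<^sup>2/2\<close>, so the kernel is \<open>(1 - ikr) e\<^bsup>ikr\<^esup> / (8\<pi>r)\<close>.  In polar
  coordinates about the pole \<open>r = 2 sin (\<theta>/2)\<close>, and the area element \<open>sin \<theta> = r cos (\<theta>/2)\<close> cancels
  the singularity; hence the eigenvalue is one quarter of the integral of
  \<open>cos (\<theta>/2) (1 - ikr) e\<^bsup>ikr\<^esup> P\<^sub>n(cos \<theta>)\<close>, which is continuous in \<open>k\<close>.  At \<open>k = 0\<close> the substitution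
  \<open>v = sin\<^sup>2 (\<theta>/2)\<close> turns it into \<open>\<integral>\<^sub>0\<^sup>1 v\<^bsup>-1/2\<^esup> P\<^sub>n(1 - 2v) dv\<close>, and Rodrigues' formula with \<open>n\<close>
  integrations by parts evaluates this to \<open>1/(n + 1/2)\<close>.\<close>

section \<open>Moments of polynomials against \<open>v^(a-1)\<close> on the unit interval\<close>

text \<open>For \<open>a > 0\<close> this is \<open>\<integral>\<^sub>0\<^sup>1 v\<^bsup>a-1\<^esup> p(v) dv\<close>.  The algebraic form makes integration by parts, which
  lowers \<open>a\<close>, valid for all non-integral \<open>a\<close>.\<close>

definition poly_mellin :: "real \<Rightarrow> real poly \<Rightarrow> real" where
  "poly_mellin a p = (\<Sum>j\<le>degree p. coeff p j / (real j + a))"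

lemma poly_mellin_altdef:
  assumes "degree p \<le> N"
  shows "poly_mellin a p = (\<Sum>j\<le>N. coeff p j / (real j + a))"
  unfolding poly_mellin_def
  by (rule sum.mono_neutral_left) (use assms in \<open>auto simp: coeff_eq_0\<close>)

lemma poly_mellin_smult: "poly_mellin a (smult c p) = c * poly_mellin a p"
  by (subst poly_mellin_altdef[of _ "degree p"])
     (auto simp: degree_smult_le poly_mellin_def sum_distrib_left)

lemma poly_mellin_diff: "poly_mellin a (p - q) = poly_mellin a p - poly_mellin a q"
proof -
  define N where "N = max (degree p) (degree q)"
  have "degree p \<le> N" "degree q \<le> N" "degree (p - q) \<le> N"
    by (auto simp: N_def degree_diff_le)
  then show ?thesis
    by (simp add: poly_mellin_altdef[of _ N] diff_divide_distrib sum_subtractf)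
qed

lemma poly_mellin_pCons_0: "poly_mellin a (pCons 0 p) = poly_mellin (a + 1) p"
proof -
  have "poly_mellin a (pCons 0 p) = (\<Sum>j\<le>Suc (degree p). coeff (pCons 0 p) j / (real j + a))"
    by (rule poly_mellin_altdef) (simp add: degree_pCons_le)
  also have "\<dots> = (\<Sum>j\<le>degree p. coeff p j / (real j + (a + 1)))"
    by (subst sum.atMost_Suc_shift) (simp add: add_ac)
  finally show ?thesis
    by (simp add: poly_mellin_def)
qed

lemma poly_mellin_X_power_mult: "poly_mellin a ([:0, 1:] ^ n * p) = poly_mellin (a + real n) p"
  by (induction n arbitrary: a) (simp_all add: poly_mellin_pCons_0 add_ac)

text \<open>Integration by parts; for \<open>a > 1\<close> the boundary term at 0 vanishes.
  Coefficientwise it is the identity j/(j + a - 1) = 1 - (a - 1)/(j + a - 1), in which the ones add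
  up to the value at 1. Non-integrality of \<open>a\<close> keeps every denominator nonzero.\<close>

lemma poly_mellin_pderiv:
  assumes "a \<notin> \<int>"
  shows "poly_mellin a (pderiv p) = poly p 1 - (a - 1) * poly_mellin (a - 1) p"
proof -
  have nz: "real j + (a - 1) \<noteq> 0" for j
  proof
    assume "real j + (a - 1) = 0"
    then have "a = of_int (1 - int j)" by simp
    then show False using assms by (metis Ints_of_int)
  qed
  have "poly_mellin a (pderiv p) = poly_mellin (a - 1) (pCons 0 (pderiv p))"
    by (simp add: poly_mellin_pCons_0)
  also have "\<dots> = (\<Sum>j\<le>Suc (degree p). coeff (pCons 0 (pderiv p)) j / (real j + (a - 1)))"
    by (rule poly_mellin_altdef) (simp add: degree_pderiv degree_pCons_eq_if)
  also have "\<dots> = (\<Sum>j\<le>Suc (degree p). coeff p j - (a - 1) * (coeff p j / (real j + (a - 1))))"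
  proof (rule sum.cong[OF refl])
    fix j
    have "coeff (pCons 0 (pderiv p)) j = real j * coeff p j"
      by (cases j) (simp_all add: coeff_pderiv)
    then show "coeff (pCons 0 (pderiv p)) j / (real j + (a - 1)) =
        coeff p j - (a - 1) * (coeff p j / (real j + (a - 1)))"
      using nz[of j] by (simp add: field_simps)
  qed
  also have "\<dots> = poly p 1 - (a - 1) * poly_mellin (a - 1) p"
    by (simp add: sum_subtractf sum_distrib_left coeff_eq_0 poly_altdef poly_mellin_def
        del: mult_minus_left)
  finally show ?thesis .
qed

lemma power_dvd_pderiv:
  assumes "q ^ Suc n dvd (p :: 'a :: idom poly)"
  shows "q ^ n dvd pderiv p"
proof -
  obtain r where "p = q ^ Suc n * r" using assms by (elim dvdE)
  then have "pderiv p = q ^ n * (q * pderiv r + smult (of_nat (Suc n)) (pderiv q * r))"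
    by (simp only: pderiv_mult pderiv_power_Suc) (simp add: algebra_simps)
  then show ?thesis by simp
qed

lemma power_dvd_higher_pderiv:
  assumes "q ^ (m + n) dvd (p :: 'a :: idom poly)"
  shows "q ^ m dvd (pderiv ^^ n) p"
  using assms
proof (induction n arbitrary: m)
  case (Suc n)
  have "q ^ Suc m dvd (pderiv ^^ n) p"
    using Suc.prems by (intro Suc.IH) simp
  then show ?case by (simp add: power_dvd_pderiv del: power_Suc)
qed simp

text \<open>Each integration by parts lowers \<open>a\<close> by one and contributes a factor 1 - a,
  2 - a, and so on. The boundary terms at 1 vanish because a derivative of order below
  \<open>n\<close> still contains a factor 1 - v.\<close>

lemma poly_mellin_higher_pderiv:
  assumes "a \<notin> \<int>" and "[:1, -1:] ^ n dvd p"
  shows "poly_mellin a ((pderiv ^^ n) p) = pochhammer (1 - a) n * poly_mellin (a - real n) p"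
  using assms
proof (induction n arbitrary: a)
  case (Suc n)
  have "[:1, -1:] ^ Suc 0 dvd (pderiv ^^ n) p"
    by (rule power_dvd_higher_pderiv) (use Suc.prems in simp)
  then have root: "poly ((pderiv ^^ n) p) 1 = 0"
    by (auto elim!: dvdE)
  have "a - 1 \<notin> \<int>"
    using Suc.prems(1) by (metis Ints_1 Ints_add diff_add_cancel)
  moreover have "[:1, -1:] ^ n dvd p"
    using Suc.prems(2) by (metis dvd_mult_right power_Suc)
  ultimately have IH: "poly_mellin (a - 1) ((pderiv ^^ n) p) =
      pochhammer (1 - (a - 1)) n * poly_mellin (a - 1 - real n) p"
    by (rule Suc.IH)
  have "poly_mellin a ((pderiv ^^ Suc n) p) = (1 - a) * poly_mellin (a - 1) ((pderiv ^^ n) p)"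
    by (simp add: poly_mellin_pderiv[OF Suc.prems(1)] root algebra_simps)
  then show ?case
    by (simp add: IH pochhammer_rec algebra_simps)
qed simp

text \<open>This is the Beta integral B(a, n + 1). The induction splits (1 - v)^(n+1) as (1 - v)^n -
  v (1 - v)^n, where the factor v shifts \<open>a\<close> to \<open>a + 1\<close>.\<close>

lemma poly_mellin_one_minus_X_power:
  assumes "a > 0"
  shows "poly_mellin a ([:1, -1:] ^ n) = fact n / pochhammer a (Suc n)"
  using assms
proof (induction n arbitrary: a)
  case 0
  then show ?case by (simp add: poly_mellin_def)
next
  case (Suc n)
  have "[:1, -1:] ^ Suc n = [:1, -1:] ^ n - pCons 0 ([:1, -1:] ^ n :: real poly)"
    by simp
  then have "poly_mellin a ([:1, -1:] ^ Suc n) =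
      fact n / pochhammer a (Suc n) - fact n / pochhammer (a + 1) (Suc n)"
    using Suc.prems by (simp only: poly_mellin_diff poly_mellin_pCons_0 Suc.IH)
  also have "\<dots> = fact n / (a * pochhammer (a + 1) n) -
      fact n / (pochhammer (a + 1) n * (a + 1 + real n))"
    by (simp add: pochhammer_rec[of a n] pochhammer_Suc[of "a + 1" n])
  also have "\<dots> = fact (Suc n) / (a * (pochhammer (a + 1) n * (a + 1 + real n)))"
  proof -
    have "pochhammer (a + 1) n \<noteq> 0"
      using pochhammer_pos[of "a + 1" n] Suc.prems by simp
    moreover have "a + 1 + real n \<noteq> 0" "a \<noteq> 0"
      using Suc.prems by linarith+
    ultimately show ?thesis
      by (simp add: divide_simps) (simp add: algebra_simps)
  qed
  also have "a * (pochhammer (a + 1) n * (a + 1 + real n)) = pochhammer a (Suc (Suc n))"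
    by (simp only: pochhammer_rec[of a "Suc n"] pochhammer_Suc[of "a + 1" n])
  finally show ?case .
qed

text \<open>The integrations by parts lower the parameter to 1/2 - n, a range where only the
  algebraic form is meaningful for general polynomials; the factor v^n raises it back to 1/2. The
  symbol \<open>pochhammer (1/2) n\<close> then cancels against the Beta integral and leaves only
  its last factor n + 1/2.\<close>

lemma poly_mellin_half_shifted_rodrigues:
  "poly_mellin (1/2) ((pderiv ^^ n) (([:0, 1:] * [:1, -1:]) ^ n)) = fact n / (real n + 1/2)"
proof -
  have "(1/2 :: real) \<notin> \<int>"
    by simp
  moreover have "[:1, -1:] ^ n dvd ([:0, 1:] * [:1, -1 :: real:]) ^ n"
    by (simp only: power_mult_distrib dvd_triv_right)
  ultimately have "poly_mellin (1/2) ((pderiv ^^ n) (([:0, 1:] * [:1, -1:]) ^ n)) =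
      pochhammer (1/2) n * poly_mellin (1/2) ([:1, -1:] ^ n)"
    by (subst poly_mellin_higher_pderiv)
       (simp_all only: power_mult_distrib poly_mellin_X_power_mult, simp_all)
  also have "\<dots> = fact n / (real n + 1/2)"
    using pochhammer_pos[of "1/2 :: real" n]
    by (simp add: poly_mellin_one_minus_X_power pochhammer_Suc add_ac)
  finally show ?thesis .
qed

section \<open>Legendre polynomials in the variable v with t = 1 - 2v\<close>

lemma higher_pderiv_pcompose_linear:
  "(pderiv ^^ n) (pcompose p [:a, b:]) = smult (b ^ n) (pcompose ((pderiv ^^ n) p) [:a, b:])"
  by (induction n) (simp_all add: pderiv_smult pderiv_pcompose pderiv_pCons mult.commute)

lemma pcompose_power: "pcompose (p ^ n) q = pcompose p q ^ n"
  by (induction n) (simp_all add: pcompose_1 pcompose_mult)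

text \<open>With t = 1 - 2v one has t^2 - 1 = -4 v (1 - v). The chain rule contributes (-2)^n, so
  (-4)^n leaves 2^n, which cancels the power of two in Rodrigues' formula.\<close>

lemma legendre_poly_pcompose:
  "pcompose (legendre_poly n) [:1, -2:] =
     smult (1 / fact n) ((pderiv ^^ n) (([:0, 1:] * [:1, -1:]) ^ n))"
proof -
  let ?D = "pcompose ((pderiv ^^ n) ([:-1, 0, 1:] ^ n)) [:1, -2 :: real:]"
  have "pcompose ([:-1, 0, 1:] ^ n) [:1, -2 :: real:] = (smult (-4) ([:0, 1:] * [:1, -1:])) ^ n"
    by (simp add: pcompose_pCons pcompose_power)
  then have "smult ((-2) ^ n) ?D = smult ((-4) ^ n) ((pderiv ^^ n) (([:0, 1:] * [:1, -1:]) ^ n))"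
    by (simp only: higher_pderiv_pcompose_linear[symmetric] smult_power higher_pderiv_smult)
  then have "smult ((-2) ^ n) ?D =
      smult ((-2) ^ n) (smult (2 ^ n) ((pderiv ^^ n) (([:0, 1:] * [:1, -1:]) ^ n)))"
    by (simp flip: power_mult_distrib)
  from arg_cong[OF this, of "smult (1 / (-2) ^ n)"]
  have "?D = smult (2 ^ n) ((pderiv ^^ n) (([:0, 1:] * [:1, -1:]) ^ n))"
    by simp
  then show ?thesis
    by (simp add: legendre_poly_def pcompose_smult)
qed

text \<open>The point t = 1 is v = 0, so the value is a constant coefficient, and Rodrigues' formula
  reduces it to the coefficient of v^n in v^n (1 - v)^n. It ensures that the zonal harmonic does not
  vanish at the pole.\<close>

lemma poly_legendre_poly_1: "poly (legendre_poly n) 1 = 1"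
proof -
  have "poly (legendre_poly n) 1 = coeff (pcompose (legendre_poly n) [:1, -2:]) 0"
    by simp
  also have "\<dots> = pochhammer 1 n * coeff ([:0, 1:] ^ n * [:1, -1:] ^ n :: real poly) n / fact n"
    by (simp only: legendre_poly_pcompose coeff_smult coeff_higher_pderiv power_mult_distrib) simp
  also have "coeff ([:0, 1:] ^ n * [:1, -1:] ^ n :: real poly) n = coeff ([:1, -1:] ^ n) 0"
    using coeff_monom_mult[of 1 n "[:1, -1:] ^ n :: real poly" n] by (simp add: monom_altdef)
  also have "\<dots> = 1"
    by (simp flip: poly_0_coeff_0)
  finally show ?thesis
    by (simp flip: pochhammer_fact)
qed

lemma poly_mellin_legendre: "poly_mellin (1/2) (pcompose (legendre_poly n) [:1, -2:]) = 1 / (real n + 1/2)"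
  by (simp only: legendre_poly_pcompose poly_mellin_smult poly_mellin_half_shifted_rodrigues) simp


section \<open>The static integral over the polar angle\<close>

text \<open>Here the algebraic \<open>poly_mellin\<close> meets an actual integral: for v =
  sin^2(\<theta>/2) one has v^(-1/2) dv = cos(\<theta>/2) d\<theta>.\<close>

lemma has_integral_cos_half_poly_sin_half:
  "((\<lambda>\<theta>. cos (\<theta> / 2) * poly p ((sin (\<theta> / 2))\<^sup>2)) has_integral poly_mellin (1/2) p) {0..pi}"
proof -
  \<comment> \<open>Termwise antiderivative: v^(j + 1/2) is the odd power 2j + 1 of sin(\<theta>/2),
    which is 0 at \<theta> = 0 and 1 at \<theta> = pi.\<close>
  define F where "F \<theta> = (\<Sum>j\<le>degree p. coeff p j / (real j + 1/2) * sin (\<theta> / 2) ^ Suc (2 * j))"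
    for \<theta> :: real
  have deriv: "((\<lambda>\<theta>. coeff p j / (real j + 1/2) * sin (\<theta> / 2) ^ Suc (2 * j)) has_real_derivative
      cos (\<theta> / 2) * (coeff p j * (sin (\<theta> / 2))\<^sup>2 ^ j)) (at \<theta> within {0..pi})" for j \<theta>
  proof -
    have "((\<lambda>\<theta>. sin (\<theta> / 2)) has_real_derivative cos (\<theta> / 2) / 2) (at \<theta> within {0..pi})"
      by (auto intro!: derivative_eq_intros)
    from DERIV_cmult[OF DERIV_power_Suc[OF this, of "2 * j"], of "coeff p j / (real j + 1/2)"]
    show ?thesis
    proof (rule DERIV_cong)
      have "(real j + 1/2) * 2 = 1 + real (2 * j)" "real j + 1/2 \<noteq> 0" by simp_all
      then show "coeff p j / (real j + 1/2) *
          ((1 + real (2 * j)) * (cos (\<theta> / 2) / 2 * sin (\<theta> / 2) ^ (2 * j))) =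
        cos (\<theta> / 2) * (coeff p j * (sin (\<theta> / 2))\<^sup>2 ^ j)"
        by (simp add: power_mult divide_simps)
    qed
  qed
  have "(F has_real_derivative (\<Sum>j\<le>degree p. cos (\<theta> / 2) * (coeff p j * (sin (\<theta> / 2))\<^sup>2 ^ j)))
      (at \<theta> within {0..pi})" for \<theta>
    unfolding F_def by (rule DERIV_sum) (rule deriv)
  then have "(F has_vector_derivative cos (\<theta> / 2) * poly p ((sin (\<theta> / 2))\<^sup>2)) (at \<theta> within {0..pi})"
    for \<theta>
    by (simp add: has_real_derivative_iff_has_vector_derivative poly_altdef sum_distrib_left)
  then have "((\<lambda>\<theta>. cos (\<theta> / 2) * poly p ((sin (\<theta> / 2))\<^sup>2)) has_integral F pi - F 0) {0..pi}"
    by (intro fundamental_theorem_of_calculus) simp_all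
  moreover have "F pi - F 0 = poly_mellin (1/2) p"
    by (simp add: F_def poly_mellin_def)
  ultimately show ?thesis by simp
qed

lemma has_integral_cos_half_legendre:
  "((\<lambda>\<theta>. cos (\<theta> / 2) * poly (legendre_poly n) (cos \<theta>)) has_integral 1 / (real n + 1/2)) {0..pi}"
proof -
  have "poly (pcompose (legendre_poly n) [:1, -2:]) ((sin (\<theta> / 2))\<^sup>2) = poly (legendre_poly n) (cos \<theta>)"
    for \<theta> :: real
    using cos_double_sin[of "\<theta> / 2"] by (simp add: poly_pcompose mult.commute)
  then show ?thesis
    using has_integral_cos_half_poly_sin_half[of "pcompose (legendre_poly n) [:1, -2:]"]
    by (simp add: poly_mellin_legendre)
qed

section \<open>The kernel on the sphere and integration in polar coordinates\<close>

lemma helmholtz_radial_derivative: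
  assumes "r \<noteq> 0"
  shows "((\<lambda>r. - exp (\<i> * complex_of_real (k * r)) / complex_of_real (4 * pi * r))
    has_vector_derivative
      (1 - \<i> * complex_of_real (k * r)) * exp (\<i> * complex_of_real (k * r)) /
        complex_of_real (4 * pi * r\<^sup>2)) (at r)"
proof -
  have "((\<lambda>z. - exp (\<i> * (of_real k * z)) / (of_real (4 * pi) * z))
     has_field_derivative
      (1 - \<i> * (of_real k * z)) * exp (\<i> * (of_real k * z)) / (of_real (4 * pi) * z\<^sup>2)) (at z)"
    if "z \<noteq> 0" for z :: complex
    using that by (auto intro!: derivative_eq_intros simp: field_simps power2_eq_square)
  from has_vector_derivative_real_field[OF this[of "of_real r"]]
  show ?thesis using assms by simp
qed

text \<open>The radial derivative of the fundamental solution is of order 1/r^2, but the cosine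
  between the normal and x - y is r/2 on the unit sphere. Only a weak singularity of order 1/r
  remains.\<close>

lemma NP_kernel_sphere:
  assumes "x \<in> sphere 0 1" "y \<in> sphere 0 1" "x \<noteq> y"
  shows "NP_kernel k x y = (1 - \<i> * complex_of_real (k * dist x y)) *
    exp (\<i> * complex_of_real (k * dist x y)) / complex_of_real (8 * pi * dist x y)"
proof -
  define r where "r = norm (x - y)"
  define g' where "g' = (1 - \<i> * complex_of_real (k * r)) * exp (\<i> * complex_of_real (k * r)) /
        complex_of_real (4 * pi * r\<^sup>2)"
  have r: "r \<noteq> 0" using assms by (simp add: r_def)
  have nx: "norm x = 1" "norm y = 1" using assms by simp_all
  have "((\<lambda>z. norm (z - y)) has_derivative (\<lambda>h. h \<bullet> sgn (x - y))) (at x)"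
    by (rule has_derivative_compose[where g = norm and f = "\<lambda>z. z - y" and f' = "\<lambda>h. h"])
       (use assms in \<open>auto intro!: derivative_eq_intros has_derivative_norm\<close>)
  from has_derivative_compose[OF this
      helmholtz_radial_derivative[of "norm (x - y)" k, unfolded has_vector_derivative_def]]
  have "((\<lambda>z. helmholtz_G k (z - y)) has_derivative (\<lambda>h. (h \<bullet> sgn (x - y)) *\<^sub>R g')) (at x)"
    using r unfolding helmholtz_G_def g'_def r_def by simp
  then have "NP_kernel k x y = (ball_normal x \<bullet> sgn (x - y)) *\<^sub>R g'"
    unfolding NP_kernel_def by (simp flip: frechet_derivative_at)
  also have "ball_normal x \<bullet> sgn (x - y) = (x \<bullet> (x - y)) / r"
    by (simp add: ball_normal_def nx sgn_div_norm r_def inverse_eq_divide)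
  also have "x \<bullet> (x - y) = r\<^sup>2 / 2"
  proof -
    have "x \<bullet> x = 1" "y \<bullet> y = 1" using nx by (simp_all flip: power2_norm_eq_inner)
    then show ?thesis
      unfolding r_def power2_norm_eq_inner by (simp add: inner_diff inner_commute)
  qed
  finally show ?thesis
    using r by (simp add: g'_def r_def[symmetric] dist_norm scaleR_conv_of_real power2_eq_square)
qed

lemma dist_pole_sphere_param:
  assumes "\<theta> \<in> {0..pi}"
  shows "dist (axis 3 1) (sphere_param (\<theta>, \<phi>)) = 2 * sin (\<theta> / 2)"
proof -
  have "(sin \<theta> * cos \<phi>)\<^sup>2 + (sin \<theta> * sin \<phi>)\<^sup>2 + (1 - cos \<theta>)\<^sup>2 = (2 * sin (\<theta> / 2))\<^sup>2"
  proof -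
    have "(sin \<theta> * cos \<phi>)\<^sup>2 + (sin \<theta> * sin \<phi>)\<^sup>2 + (1 - cos \<theta>)\<^sup>2 = 2 - 2 * cos \<theta>"
      using sin_cos_squared_add[of \<theta>] sin_cos_squared_add[of \<phi>] by algebra
    also have "\<dots> = (2 * sin (\<theta> / 2))\<^sup>2"
      using cos_double_sin[of "\<theta> / 2"] by simp
    finally show ?thesis .
  qed
  then have "dist (axis 3 1) (sphere_param (\<theta>, \<phi>)) = sqrt ((2 * sin (\<theta> / 2))\<^sup>2)"
    by (simp add: dist_norm norm_vec_def L2_set_def sum_3 sphere_param_def vector_3 axis_def)
  also have "\<dots> = 2 * sin (\<theta> / 2)"
    using assms by (simp only: real_sqrt_abs) (simp add: sin_ge_zero)
  finally show ?thesis .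
qed

lemma norm_sphere_param: "norm (sphere_param (\<theta>, \<phi>)) = 1"
proof -
  have "(sin \<theta> * cos \<phi>)\<^sup>2 + (sin \<theta> * sin \<phi>)\<^sup>2 + (cos \<theta>)\<^sup>2 = 1"
    using sin_cos_squared_add[of \<theta>] sin_cos_squared_add[of \<phi>] by algebra
  then show ?thesis
    by (simp add: norm_vec_def L2_set_def sum_3 sphere_param_def vector_3)
qed

text \<open>Fubini in spherical coordinates, the azimuth contributing 2 pi. The area density is kept
  inside \<open>g\<close>, so that it can cancel a factor 1/r of \<open>f\<close> before
  integrability is considered.\<close>

lemma integral_sphere_measure_zonal:
  fixes f :: "real^3 \<Rightarrow> complex" and g :: "real \<Rightarrow> complex"
  assumes f: "f \<in> borel_measurable borel"
    and fg: "\<And>\<theta> \<phi>. \<theta> \<in> {0..pi} \<Longrightarrow> sin \<theta> *\<^sub>R f (sphere_param (\<theta>, \<phi>)) = g \<theta>"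
    and g: "set_integrable lborel {0..pi} g"
  shows "integral\<^sup>L sphere_measure f = (2 * pi) *\<^sub>R (LINT \<theta>:{0..pi}|lborel. g \<theta>)"
proof -
  define w where "w = (\<lambda>(\<theta>, \<phi>). indicator ({0..pi} \<times> {0..2 * pi}) (\<theta>, \<phi>) * sin \<theta> :: real)"
  define h where "h \<theta> = indicator {0..pi} \<theta> *\<^sub>R g \<theta>" for \<theta>
  define J where "J \<phi> = (indicator {0..2 * pi} \<phi> :: real)" for \<phi>
  have h: "integrable lborel h" using g by (simp add: h_def[abs_def] set_integrable_def)
  have J: "integrable lborel J" "integral\<^sup>L lborel J = 2 * pi" 
    by (simp_all add: J_def[abs_def])
  have [measurable]: "sphere_param \<in> borel_measurable (borel \<Otimes>\<^sub>M borel)"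
    using sphere_param_measurable by (simp add: borel_prod)
  have w: "w \<in> borel_measurable lborel"
    unfolding w_def case_prod_beta
    by (intro borel_measurable_times borel_measurable_indicator')
       (auto simp flip: borel_prod intro!: borel_measurable_continuous_onI continuous_intros)
  have w0: "0 \<le> w z" for z
    by (auto simp: w_def indicator_def sin_ge_zero split: prod.splits)
  have "integral\<^sup>L sphere_measure f =
      (LINT z|density lborel w. f (sphere_param z))"
    unfolding sphere_measure_def w_def[symmetric] case_prod_beta
    using f sphere_param_measurable by (subst integral_distr) (simp_all add: w_def case_prod_beta)
  also have "\<dots> = (LINT z|lborel. w z *\<^sub>R f (sphere_param z))"
    using f sphere_param_measurable w w0 by (subst integral_density) auto
  also have "\<dots> = (LINT z|lborel. J (snd z) *\<^sub>R h (fst z))"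
  proof (rule Bochner_Integration.integral_cong[OF refl])
    fix z :: "real \<times> real"
    obtain \<theta> \<phi> where z: "z = (\<theta>, \<phi>)" by (cases z)
    show "w z *\<^sub>R f (sphere_param z) = J (snd z) *\<^sub>R h (fst z)"
      using fg[of \<theta> \<phi>] by (auto simp: z w_def J_def h_def indicator_def)
  qed
  also have "\<dots> = (LINT z|(lborel \<Otimes>\<^sub>M lborel). J (snd z) *\<^sub>R h (fst z))"
    by (simp add: lborel_prod)
  also have "\<dots> = (LINT \<theta>|lborel. LINT \<phi>|lborel. J \<phi> *\<^sub>R h \<theta>)"
  proof -
    have [measurable]: "h \<in> borel_measurable borel" "J \<in> borel_measurable borel"
      using h J by (auto dest: borel_measurable_integrable)
    have "integrable (lborel \<Otimes>\<^sub>M lborel) (\<lambda>z. J (snd z) *\<^sub>R h (fst z))"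
      by (rule lborel_pair.Fubini_integrable) (use h J in \<open>simp_all\<close>)
    from lborel_pair.integral_fst'[OF this] show ?thesis by simp
  qed
  also have "\<dots> = (2 * pi) *\<^sub>R integral\<^sup>L lborel h"
    using J by simp
  finally show ?thesis by (simp add: h_def[abs_def] set_lebesgue_integral_def)
qed


section \<open>The principal value at the north pole\<close>

text \<open>Away from \<theta> = 0 this is 8 pi sin \<theta> times the kernel at the pole times
  P_n(cos \<theta>). Having no division, it is jointly continuous in \<open>k\<close> and
  \<open>\<theta>\<close>, also at \<theta> = 0 and k = 0.\<close>

definition zonal_integrand :: "nat \<Rightarrow> real \<Rightarrow> real \<Rightarrow> complex" where
  "zonal_integrand n k \<theta> = (1 - \<i> * complex_of_real (k * (2 * sin (\<theta> / 2)))) *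
     exp (\<i> * complex_of_real (k * (2 * sin (\<theta> / 2)))) *
     complex_of_real (cos (\<theta> / 2) * poly (legendre_poly n) (cos \<theta>))"

lemma continuous_on_zonal_integrand [continuous_intros]:
  fixes f g :: "'a :: t2_space \<Rightarrow> real"
  assumes "continuous_on A f" "continuous_on A g"
  shows "continuous_on A (\<lambda>x. zonal_integrand n (f x) (g x))"
  unfolding zonal_integrand_def by (auto intro!: continuous_intros assms)

lemma sph_harm_0:
  "sph_harm n 0 x = complex_of_real (sqrt ((2 * real n + 1) / (4 * pi)) * poly (legendre_poly n) (x $ 3))"
  by (simp add: sph_harm_def assoc_legendre_def)

text \<open>The removed cap becomes a condition on the chord length 2 sin(\<theta>/2). The factor
  1/4 is 2 pi from the azimuth times 1/(8 pi) from the kernel.\<close>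

lemma NP_sph_harm_truncated_pole:
  assumes "0 < \<epsilon>"
  shows "(LINT y:{y \<in> sphere 0 1. \<epsilon> < dist (axis 3 1) y}|sphere_measure.
      NP_kernel k (axis 3 1) y * sph_harm n 0 y) =
    complex_of_real (sqrt ((2 * real n + 1) / (4 * pi))) / 4 *
      (LINT \<theta>:{0..pi}|lborel. indicator {\<theta>. \<epsilon> < 2 * sin (\<theta> / 2)} \<theta> *\<^sub>R zonal_integrand n k \<theta>)"
proof -
  define c where "c = sqrt ((2 * real n + 1) / (4 * pi))"
  define S where "S = {y \<in> sphere 0 1. \<epsilon> < dist (axis 3 1) (y :: real^3)}"
  \<comment> \<open>A closed form that agrees with the integrand on \<open>S\<close> and is visibly
    Borel measurable, whereas \<open>NP_kernel\<close> is given as a Frechet derivative.\<close>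
  define F where "F y = (1 - \<i> * complex_of_real (k * dist (axis 3 1) y)) *
    exp (\<i> * complex_of_real (k * dist (axis 3 1) y)) / complex_of_real (8 * pi * dist (axis 3 1) y)
     * complex_of_real (c * poly (legendre_poly n) (y $ 3))" for y :: "real^3"
  define g where "g \<theta> = indicator {\<theta>. \<epsilon> < 2 * sin (\<theta> / 2)} \<theta> *\<^sub>R
     (complex_of_real (c / (8 * pi)) * zonal_integrand n k \<theta>)" for \<theta>
  have S: "S \<in> sets borel"
    unfolding S_def by measurable
  have [measurable]: "(\<lambda>y :: real^3. y $ 3) \<in> borel_measurable borel"
    by (intro borel_measurable_continuous_onI continuous_intros)
  have [measurable]: "poly (legendre_poly n) \<in> borel_measurable borel"
    by (intro borel_measurable_continuous_onI continuous_intros)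
  have F: "F \<in> borel_measurable borel"
    unfolding F_def by measurable
  have "(LINT y:S|sphere_measure. NP_kernel k (axis 3 1) y * sph_harm n 0 y) =
      integral\<^sup>L sphere_measure (\<lambda>y. indicator S y *\<^sub>R F y)"
    unfolding set_lebesgue_integral_def
  proof (rule Bochner_Integration.integral_cong[OF refl])
    fix y :: "real^3"
    show "indicator S y *\<^sub>R (NP_kernel k (axis 3 1) y * sph_harm n 0 y) = indicator S y *\<^sub>R F y"
    proof (cases "y \<in> S")
      case True
      then have "axis 3 1 \<noteq> y" "y \<in> sphere 0 1"
        using assms by (auto simp: S_def)
      then show ?thesis
        by (simp add: NP_kernel_sphere F_def sph_harm_0 c_def norm_axis_1)
    qed simp
  qed
  also have "\<dots> = (2 * pi) *\<^sub>R (LINT \<theta>:{0..pi}|lborel. g \<theta>)"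
  proof (rule integral_sphere_measure_zonal)
    show "(\<lambda>y. indicator S y *\<^sub>R F y) \<in> borel_measurable borel"
      using S F by measurable
  next
    fix \<theta> \<phi> :: real
    assume \<theta>: "\<theta> \<in> {0..pi}"
    define r where "r = 2 * sin (\<theta> / 2)"
    have d: "dist (axis 3 1) (sphere_param (\<theta>, \<phi>)) = r"
      unfolding r_def by (rule dist_pole_sphere_param[OF \<theta>])
    have c3: "sphere_param (\<theta>, \<phi>) $ 3 = cos \<theta>"
      by (simp add: sphere_param_def vector_3)
    have inS: "sphere_param (\<theta>, \<phi>) \<in> S \<longleftrightarrow> \<epsilon> < r"
      by (simp add: S_def d norm_sphere_param)
    have s: "sin \<theta> = r * cos (\<theta> / 2)"
      using sin_double[of "\<theta> / 2"] by (simp add: r_def)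
    show "sin \<theta> *\<^sub>R indicator S (sphere_param (\<theta>, \<phi>)) *\<^sub>R F (sphere_param (\<theta>, \<phi>)) = g \<theta>"
    proof (cases "\<epsilon> < r")
      case True
      \<comment> \<open>Off the cap the factor r of the area element cancels the 1/r of the
        kernel.\<close>
      then have "r \<noteq> 0" using assms by simp
      with True show ?thesis
        by (simp add: g_def F_def zonal_integrand_def inS d c3 s scaleR_conv_of_real
            flip: r_def)
    next
      case False
      then show ?thesis by (simp add: g_def inS r_def)
    qed
  next
    have "set_integrable lborel {0..pi}
        (\<lambda>\<theta>. complex_of_real (c / (8 * pi)) * zonal_integrand n k \<theta>)"
      by (intro borel_integrable_atLeastAtMost' continuous_intros)
    then have "integrable lborel (\<lambda>\<theta>. indicator {\<theta>. \<epsilon> < 2 * sin (\<theta> / 2)} \<theta> *\<^sub>R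
         indicator {0..pi} \<theta> *\<^sub>R (complex_of_real (c / (8 * pi)) * zonal_integrand n k \<theta>))"
      unfolding set_integrable_def
      by (rule integrable_mult_indicator[rotated]) simp
    then show "set_integrable lborel {0..pi} g"
      unfolding set_integrable_def g_def by (simp only: scaleR_left_commute)
  qed
  also have "(LINT \<theta>:{0..pi}|lborel. g \<theta>) = complex_of_real (c / (8 * pi)) *
     (LINT \<theta>:{0..pi}|lborel. indicator {\<theta>. \<epsilon> < 2 * sin (\<theta> / 2)} \<theta> *\<^sub>R zonal_integrand n k \<theta>)"
    unfolding g_def by (subst set_integral_mult_right[symmetric]) (simp only: mult_scaleR_right)
  finally show ?thesis
    by (simp add: S_def c_def scaleR_conv_of_real)
qed

text \<open>After the cancellation the integrand is continuous, so the principal value is an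
  ordinary limit: the caps shrink to the pole and dominated convergence applies, with the full
  integrand as bound.\<close>

lemma NP_sph_harm_pole:
  "NP k (sph_harm n 0) (axis 3 1) =
    complex_of_real (sqrt ((2 * real n + 1) / (4 * pi))) / 4 * integral {0..pi} (zonal_integrand n k)"
proof -
  define I where "I \<epsilon> = (LINT \<theta>:{0..pi}|lborel.
      indicator {\<theta>. \<epsilon> < 2 * sin (\<theta> / 2)} \<theta> *\<^sub>R zonal_integrand n k \<theta>)" for \<epsilon>
  have int: "set_integrable lborel {0..pi} (zonal_integrand n k)"
    by (intro borel_integrable_atLeastAtMost' continuous_intros)
  have "(I \<longlongrightarrow> (LINT \<theta>:{0..pi}|lborel. zonal_integrand n k \<theta>)) (at_right 0)"
  \<comment> \<open>Dominated convergence concerns sequences, so the one-sided limit is tested along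
    sequences tending to 0.\<close>
  proof (rule tendsto_at_right_sequentially[of 0 1])
    fix e :: "nat \<Rightarrow> real"
    assume e: "e \<longlonglongrightarrow> 0"
    show "(\<lambda>i. I (e i)) \<longlonglongrightarrow> (LINT \<theta>:{0..pi}|lborel. zonal_integrand n k \<theta>)"
      unfolding I_def set_lebesgue_integral_def
    proof (rule integral_dominated_convergence)
      show "integrable lborel (\<lambda>\<theta>. norm (indicator {0..pi} \<theta> *\<^sub>R zonal_integrand n k \<theta>))"
        using int unfolding set_integrable_def by (rule integrable_norm)
      show "(\<lambda>\<theta>. indicator {0..pi} \<theta> *\<^sub>R zonal_integrand n k \<theta>) \<in> borel_measurable lborel"
        using int unfolding set_integrable_def by (rule borel_measurable_integrable)
      have "zonal_integrand n k \<in> borel_measurable borel"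
        by (intro borel_measurable_continuous_onI continuous_intros)
      then show "(\<lambda>\<theta>. indicator {0..pi} \<theta> *\<^sub>R indicator {\<theta>. e i < 2 * sin (\<theta> / 2)} \<theta> *\<^sub>R
          zonal_integrand n k \<theta>) \<in> borel_measurable lborel" for i
        by measurable
      show "AE \<theta> in lborel. norm (indicator {0..pi} \<theta> *\<^sub>R indicator {\<theta>. e i < 2 * sin (\<theta> / 2)} \<theta> *\<^sub>R
          zonal_integrand n k \<theta>) \<le> norm (indicator {0..pi} \<theta> *\<^sub>R zonal_integrand n k \<theta>)" for i
        by (auto simp: indicator_def)
      show "AE \<theta> in lborel. (\<lambda>i. indicator {0..pi} \<theta> *\<^sub>R indicator {\<theta>. e i < 2 * sin (\<theta> / 2)} \<theta> *\<^sub>R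
          zonal_integrand n k \<theta>) \<longlonglongrightarrow> indicator {0..pi} \<theta> *\<^sub>R zonal_integrand n k \<theta>"
        \<comment> \<open>At \<theta> = 0 the chord length is 0 and the indicator need not become 1;
          this single point is null.\<close>
        using AE_lborel_singleton[of 0]
      proof eventually_elim
        case (elim \<theta>)
        show ?case
        proof (cases "\<theta> \<in> {0..pi}")
          case True
          with elim have "0 < 2 * sin (\<theta> / 2)"
            by (simp add: sin_gt_zero)
          with e have "\<forall>\<^sub>F i in sequentially. e i < 2 * sin (\<theta> / 2)"
            by (rule order_tendstoD)
          then show ?thesis
            by (intro tendsto_eventually) (auto elim: eventually_mono)
        qed simp
      qed
    qed
  qed simp
  then have "((\<lambda>\<epsilon>. complex_of_real (sqrt ((2 * real n + 1) / (4 * pi))) / 4 * I \<epsilon>) \<longlongrightarrow>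
      complex_of_real (sqrt ((2 * real n + 1) / (4 * pi))) / 4 * integral {0..pi} (zonal_integrand n k))
      (at_right 0)"
    by (intro tendsto_intros) (simp add: set_borel_integral_eq_integral[OF int])
  then have "((\<lambda>\<epsilon>. LINT y:{y \<in> sphere 0 1. \<epsilon> < dist (axis 3 1) y}|sphere_measure.
        NP_kernel k (axis 3 1) y * sph_harm n 0 y) \<longlongrightarrow>
      complex_of_real (sqrt ((2 * real n + 1) / (4 * pi))) / 4 * integral {0..pi} (zonal_integrand n k))
      (at_right 0)"
    by (rule Lim_transform_eventually)
       (rule eventually_mono[OF eventually_at_right_less],
         simp only: NP_sph_harm_truncated_pole I_def)
  then show ?thesis
    unfolding NP_def by (intro tendsto_Lim) simp_all
qed

section \<open>The limit of the eigenvalues\<close>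

theorem theorem3p1:
  fixes \<tau> :: "nat \<Rightarrow> real \<Rightarrow> complex"
  assumes eigenvalue: "\<And>n m k x. 0 < k \<Longrightarrow> \<bar>m\<bar> \<le> int n \<Longrightarrow> x \<in> sphere 0 1 \<Longrightarrow>
      NP k (sph_harm n m) x = \<tau> n k * sph_harm n m x"
  shows "\<forall>n. ((\<lambda>k. \<tau> n k) \<longlongrightarrow> complex_of_real (1 / (2 * (2 * real n + 1)))) (at_right 0)"
proof
  fix n
  let ?J = "\<lambda>k. integral {0..pi} (zonal_integrand n k)"
  \<comment> \<open>Since P_n(1) = 1, the zonal harmonic at the pole equals its normalisation
    constant, which is nonzero and cancels from both sides.\<close>
  have \<tau>: "?J k / 4 = \<tau> n k" if "0 < k" for k
    using eigenvalue[of k 0 n "axis 3 1"] that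
    by (simp add: NP_sph_harm_pole sph_harm_0 poly_legendre_poly_1 norm_axis_1 axis_nth)
  \<comment> \<open>The integrand is jointly continuous and the interval compact, so the integral is
    continuous in \<open>k\<close> on all of the real line, in particular at 0.\<close>
  have "continuous_on UNIV (\<lambda>k. integral (cbox 0 pi) (zonal_integrand n k))"
    by (rule integral_continuous_on_param) (auto simp: case_prod_beta intro!: continuous_intros)
  then have "((\<lambda>k. ?J k / 4) \<longlongrightarrow> ?J 0 / 4) (at_right 0)"
    by (intro tendsto_intros)
       (auto simp: continuous_on_eq_continuous_at isCont_def intro: tendsto_within_subset)
  \<comment> \<open>At k = 0 the factor (1 - ikr) e^(ikr) is 1, which leaves the real static
    integral.\<close>
  moreover have "(zonal_integrand n 0 has_integral complex_of_real (1 / (real n + 1/2))) {0..pi}"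
    using has_integral_of_real[OF has_integral_cos_half_legendre[of n], where ?'b = complex]
    by (simp add: zonal_integrand_def[abs_def] o_def)
  then have "?J 0 = complex_of_real (1 / (real n + 1/2))"
    by (rule integral_unique)
  moreover have "1 / (real n + 1/2) / 4 = 1 / (2 * (2 * real n + 1))"
    by (simp add: field_simps)
  then have "complex_of_real (1 / (real n + 1/2)) / 4 = complex_of_real (1 / (2 * (2 * real n + 1)))"
    by (metis of_real_divide of_real_numeral)
  ultimately have "((\<lambda>k. ?J k / 4) \<longlongrightarrow> complex_of_real (1 / (2 * (2 * real n + 1)))) (at_right 0)"
    by (simp only:)
  then show "((\<lambda>k. \<tau> n k) \<longlongrightarrow> complex_of_real (1 / (2 * (2 * real n + 1)))) (at_right 0)"
    by (rule Lim_transform_eventually) (rule eventually_mono[OF eventually_at_right_less], rule \<tau>)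
qed

end
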